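(* Let $\mu$ be a probability measure on $\{0,1,2,3\}$, let $\gamma\in(0,1)$, and let $c:\mathbb N^4\to\mathbb R_+$, $c(\mathbf x)=c_0x_0+c_1x_1+c_2x_2+c_3x_3$, be an admissible linear cost function, i.e. $c_0,c_1,c_2,c_3\ge 0$, $c_2\le c_0$ and $c_1\le c_3$. Consider the general stochastic matching model on the N-graph with arrival distribution $\mu$, and the problem of minimizing over admissible policies $\pi$ the discounted cost $$v^\pi_\gamma(\mathbf x)=\lim_{N\to+\infty}\sum_{n=0}^{N}\gamma^n\,\mathbb E^\pi_{\mathbf x}[c(X_n)].$$ Then there exists an optimal stationary policy of the threshold type; that is, there exists a threshold type decision rule $u^\star$ (with priority for $\ell_1$ and $\ell_3$, and some thresholds $(t_i)_{i\in\mathbb Z}$ in $\mathbb N\cup\{+\infty\}$ in $\ell_2$) such that the stationary policy $\pi^\star=(u^\star,u^\star,\dots)$ satisfies $v^{\pi^\star}_\gamma(\mathbf x)=\inf_{\pi}v^\pi_\gamma(\mathbf x)$ for all $\mathbf x\in\mathbb N^4$, the infimum being over all admissible policies.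
   Context: Notation: $\mathbb N$ is the set of non-negative integers; $\mathbf e_0,\mathbf e_1,\mathbf e_2,\mathbf e_3$ is the canonical basis of $\mathbb R^4$; vectors are indexed $\mathbf x=(x_0,x_1,x_2,x_3)$; $a\wedge b=\min(a,b)$, $a^+=\max(a,0)$. N-graph: nodes (item classes) $0,1,2,3$ and edges $\ell_1=\{0,1\}$, $\ell_2=\{1,2\}$, $\ell_3=\{2,3\}$. Each edge $\{i,j\}$ is identified with the vector $\mathbf e_i+\mathbf e_j$, so $\ell_1=(1,1,0,0)$, $\ell_2=(0,1,1,0)$, $\ell_3=(0,0,1,1)$. Matchings: for $\mathbf x\in\mathbb N^4$, consider a graph having $x_i$ nodes of type $i$ for each $i$, with two nodes of types $i\neq j$ adjacent iff $\{i,j\}$ is an edge of the N-graph. $\mathbf M_{\mathbf x}$ is the set of matchings of this graph, a matching being identified with the vector counting the matched items of each class. Thus $\mathbf M_{\mathbf x}$ is the set of vectors $\mathbf m=a\ell_1+b\ell_2+d\ell_3$ with $a,b,d\in\mathbb N$ (the numbers of $\ell_1$, $\ell_2$, $\ell_3$ edges) such that $\mathbf x-\mathbf m\in\mathbb N^4$. Model: arrivals $(A_n)$ are i.i.d. with $\mathbb P(A_n=\mathbf e_i)=\mu(i)$, $i\in\{0,1,2,3\}$, drawn independently of everything else. The state $X_n\in\mathbb N^4$ records the numbers of stored items of each class just after time $n$. A Markovian decision rule at time $n$ is an operator $u_n:\mathbb N^4\to\mathbb N^4$ with $\mathbf x-u_n(\mathbf x)\in\mathbf M_{\mathbf x}$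 for all $\mathbf x$ (it executes a possible, not necessarily maximal, matching), which is either deterministic or random and independent of the filtration generated by $X_p$, $p\le n$. The dynamics are $X_{n+1}=u_n(X_n)+A_{n+1}$. An admissible policy is a sequence $\pi=(u_n)_{n\in\mathbb N}$ of Markovian decision rules; it is stationary if $u_n=u$ for all $n$. $\mathbb E^\pi_{\mathbf x}$ is expectation under policy $\pi$ given $X_0=\mathbf x$. Threshold type decision rule: given a family $(t_i)_{i\in\mathbb Z}$ in $\mathbb N\cup\{+\infty\}$, the threshold type decision rule with priority for $\ell_1$ and $\ell_3$ and thresholds $(t_i)_{i\in\mathbb Z}$ in $\ell_2$ is the map $u(\mathbf x)=\mathbf x-m(\mathbf x)$, where $$m(\mathbf x)=(x_0\wedge x_1)\ell_1+(x_2\wedge x_3)\ell_3+k_{t_{i(\mathbf x)}}(\mathbf x)\,\ell_2,$$ $$k_t(\mathbf x)=\big((x_1-x_0)\wedge(x_2-x_3)-t\big)^+,\qquad i(\mathbf x)=(x_1-x_0)-(x_2-x_3),$$ with $k_{+\infty}(\mathbf x)=0$. A policy is of the threshold type if all its decision rules are of this form. *)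

theory Defs
  imports "HOL-Probability.Probability" "HOL-Library.Extended_Nat"
begin

(* The item classes 0, 1, 2, 3 are the elements of the four-element type 4, so that x $ i is x_i
   and the canonical basis vector e_i is axis i 1. *)

type_synonym state = "nat ^ 4"

definition edge1 :: state where
  "edge1 = axis 0 1 + axis 1 1"

definition edge2 :: state where
  "edge2 = axis 1 1 + axis 2 1"

definition edge3 :: state where
  "edge3 = axis 2 1 + axis 3 1"

definition matchings :: "state \<Rightarrow> state set" where
  "matchings x = {m. (\<exists>a b d. m = a *s edge1 + b *s edge2 + d *s edge3) \<and> m \<le> x}"

(* The first conjunct makes the truncated subtraction of naturals in the second one exact. *)
definition decision_rule :: "(state \<Rightarrow> state) \<Rightarrow> bool" where
  "decision_rule u \<longleftrightarrow> (\<forall>x. u x \<le> x \<and> x - u x \<in> matchings x)"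

(* Operators on states carry the sigma-algebra generated by the evaluations at the states. *)
definition operator_space :: "(state \<Rightarrow> state) measure" where
  "operator_space = (\<Pi>\<^sub>M x\<in>UNIV. count_space UNIV)"

definition operator_seq_space :: "(nat \<Rightarrow> state \<Rightarrow> state) measure" where
  "operator_seq_space = (\<Pi>\<^sub>M n\<in>UNIV. operator_space)"

(* A policy is represented by the joint law P of its (possibly random) decision rules u_0, u_1, ...
   Sample points are pairs (U, A): U n is the realization of u_n, and A n is the class of the item
   arriving at time n. Under path_space \<mu> P the arrival classes are i.i.d. with law \<mu> and
   independent of the decision rules. A 0 is not used. *)
definition path_space ::
    "4 pmf \<Rightarrow> (nat \<Rightarrow> state \<Rightarrow> state) measure \<Rightarrow> ((nat \<Rightarrow> state \<Rightarrow> state) \<times> (nat \<Rightarrow> 4)) measure" where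
  "path_space \<mu> P = P \<Otimes>\<^sub>M (\<Pi>\<^sub>M n\<in>UNIV. measure_pmf \<mu>)"

primrec state_at ::
    "state \<Rightarrow> nat \<Rightarrow> (nat \<Rightarrow> state \<Rightarrow> state) \<times> (nat \<Rightarrow> 4) \<Rightarrow> state" where
  "state_at x 0 \<omega> = x"
| "state_at x (Suc n) \<omega> = fst \<omega> n (state_at x n \<omega>) + axis (snd \<omega> (Suc n)) 1"

definition operator_events ::
    "4 pmf \<Rightarrow> (nat \<Rightarrow> state \<Rightarrow> state) measure \<Rightarrow> nat
      \<Rightarrow> ((nat \<Rightarrow> state \<Rightarrow> state) \<times> (nat \<Rightarrow> 4)) set set" where
  "operator_events \<mu> P n =
     sets (vimage_algebra (space (path_space \<mu> P)) (\<lambda>\<omega>. fst \<omega> n) operator_space)"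

(* The sigma-algebra generated by X_0, ..., X_n when X_0 = x. *)
definition history_events ::
    "4 pmf \<Rightarrow> (nat \<Rightarrow> state \<Rightarrow> state) measure \<Rightarrow> state \<Rightarrow> nat
      \<Rightarrow> ((nat \<Rightarrow> state \<Rightarrow> state) \<times> (nat \<Rightarrow> 4)) set set" where
  "history_events \<mu> P x n =
     sets (vimage_algebra (space (path_space \<mu> P)) (\<lambda>\<omega>. \<lambda>p\<in>{..n}. state_at x p \<omega>)
       (\<Pi>\<^sub>M p\<in>{..n}. count_space UNIV))"

(* Deterministic policies are the Dirac measures; for them the independence condition is void. *)
definition admissible_policy :: "4 pmf \<Rightarrow> (nat \<Rightarrow> state \<Rightarrow> state) measure \<Rightarrow> bool" where
  "admissible_policy \<mu> P \<longleftrightarrow>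
     prob_space P \<and> sets P = sets operator_seq_space \<and>
     (AE U in P. \<forall>n. decision_rule (U n)) \<and>
     (\<forall>x n. prob_space.indep_set (path_space \<mu> P) (operator_events \<mu> P n) (history_events \<mu> P x n))"

definition stationary_policy :: "(state \<Rightarrow> state) \<Rightarrow> (nat \<Rightarrow> state \<Rightarrow> state) measure" where
  "stationary_policy u = return operator_seq_space (\<lambda>n. u)"

definition linear_cost :: "(4 \<Rightarrow> real) \<Rightarrow> state \<Rightarrow> real" where
  "linear_cost c x = c 0 * real (x $ 0) + c 1 * real (x $ 1) + c 2 * real (x $ 2) + c 3 * real (x $ 3)"

definition admissible_cost :: "(4 \<Rightarrow> real) \<Rightarrow> bool" where
  "admissible_cost c \<longleftrightarrow> (\<forall>i. 0 \<le> c i) \<and> c 2 \<le> c 0 \<and> c 1 \<le> c 3"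

(* Costs are nonnegative, so expectations and the increasing limit are taken in [0, \<infinity>]. *)
definition discounted_cost ::
    "4 pmf \<Rightarrow> real \<Rightarrow> (state \<Rightarrow> real) \<Rightarrow> (nat \<Rightarrow> state \<Rightarrow> state) measure \<Rightarrow> state \<Rightarrow> ennreal" where
  "discounted_cost \<mu> \<gamma> f P x =
     lim (\<lambda>N. \<Sum>n\<le>N. ennreal (\<gamma> ^ n) * (\<integral>\<^sup>+ \<omega>. ennreal (f (state_at x n \<omega>)) \<partial>path_space \<mu> P))"

definition imbalance :: "state \<Rightarrow> int" where
  "imbalance x = (int (x $ 1) - int (x $ 0)) - (int (x $ 2) - int (x $ 3))"

(* The function nat maps an integer z to max z 0. *)
definition num_edge2 :: "enat \<Rightarrow> state \<Rightarrow> nat" where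
  "num_edge2 t x =
     (case t of
        enat s \<Rightarrow> nat (min (int (x $ 1) - int (x $ 0)) (int (x $ 2) - int (x $ 3)) - int s)
      | \<infinity> \<Rightarrow> 0)"

definition threshold_matching :: "(int \<Rightarrow> enat) \<Rightarrow> state \<Rightarrow> state" where
  "threshold_matching t x =
     min (x $ 0) (x $ 1) *s edge1 + min (x $ 2) (x $ 3) *s edge3
       + num_edge2 (t (imbalance x)) x *s edge2"

definition threshold_rule :: "(int \<Rightarrow> enat) \<Rightarrow> state \<Rightarrow> state" where
  "threshold_rule t x = x - threshold_matching t x"

(* Hence the subtraction in threshold_rule is never truncated. *)
lemma threshold_matching_mem: "threshold_matching t x \<in> matchings x"
proof -
  have four: "(4 :: 4) = 0"
    by simp
  have "threshold_matching t x \<le> x"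
    unfolding less_eq_vec_def forall_4 four
    by (auto simp: threshold_matching_def num_edge2_def edge1_def edge2_def edge3_def axis_def
        split: enat.split)
  moreover have "threshold_matching t x = min (x $ 0) (x $ 1) *s edge1
      + num_edge2 (t (imbalance x)) x *s edge2 + min (x $ 2) (x $ 3) *s edge3"
    by (simp add: threshold_matching_def add_ac)
  ultimately show ?thesis
    unfolding matchings_def by blast
qed

end

theory Submission
  imports Defs
begin

text \<open>
  After the \<open>\<ell>\<^sub>1\<close> and \<open>\<ell>\<^sub>3\<close> edges are matched as often as possible, a state is determined by the two
  excesses \<open>p = x\<^sub>1 - x\<^sub>0\<close> and \<open>q = x\<^sub>2 - x\<^sub>3\<close>. An \<open>\<ell>\<^sub>2\<close> edge lowers both by one, that is, it moves
  the state down a diagonal of the integer plane, and an arrival moves the state by one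
  unit vector. In these coordinates the problem becomes the equation
  \<open>h = running_min (cost_to_go h)\<close>, where \<open>cost_to_go h\<close> is the cost of waiting at \<open>(p, q)\<close> and
  \<open>running_min\<close> chooses how far to move down the diagonal before waiting.

  The class of functions that are convex and nonincreasing along all diagonals reproduces itself
  under this equation. If \<open>h\<close> belongs to it, \<open>cost_to_go h\<close> is convex along diagonals, and it is
  nonincreasing where \<open>p \<le> 0\<close> or \<open>q \<le> 0\<close>, because the inequalities \<open>c 2 \<le> c 0\<close> and
  \<open>c 1 \<le> c 3\<close> give this for the immediate cost. The running minimum of such a function is again
  convex and now nonincreasing everywhere (\<open>running_min_convex\<close>, \<open>running_min_antimono\<close>). Value
  iteration from 0 thus stays in the class; it increases and is bounded by a linear function, so it
  converges to a solution \<open>h\<close> in the class (\<open>value_fixed_point\<close>).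

  By convexity, each diagonal has one position such that it is optimal to move down to it from above and
  to stay put below it, which is the threshold rule (\<open>running_min_attained_at_threshold\<close>). Monotonicity of \<open>h\<close>
  along the whole diagonal means that nothing is gained by spending on \<open>\<ell>\<^sub>2\<close> edges the items that \<open>\<ell>\<^sub>1\<close> or
  \<open>\<ell>\<^sub>3\<close> could take. Hence \<open>W x = c x + \<gamma> * h p q\<close> satisfies the optimality inequality for every
  decision rule (\<open>state_value_le_decision\<close>) and equality for the threshold rule
  (\<open>state_value_eq_threshold\<close>).

  Iterating these relations along the state process shows that \<open>W\<close> is a lower bound for the
  discounted cost of every policy and an upper bound for that of the threshold policy
  (\<open>discounted_cost_ge\<close>, \<open>discounted_cost_stationary_le\<close>).
\<close>

section \<open>Running minima along the diagonals of the integer plane\<close>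

definition diag_convex :: "(int \<Rightarrow> int \<Rightarrow> real) \<Rightarrow> bool" where
  "diag_convex f \<longleftrightarrow> (\<forall>p q. 2 * f p q \<le> f (p + 1) (q + 1) + f (p - 1) (q - 1))"

definition diag_antimono :: "(int \<Rightarrow> int \<Rightarrow> real) \<Rightarrow> bool" where
  "diag_antimono f \<longleftrightarrow> (\<forall>p q. f p q \<le> f (p - 1) (q - 1))"

text \<open>Where \<open>p \<le> 0\<close> or \<open>q \<le> 0\<close>, no \<open>\<ell>\<^sub>2\<close> edge is left once \<open>\<ell>\<^sub>1\<close> and \<open>\<ell>\<^sub>3\<close> have been matched. The
  point \<open>(p - 1, q - 1)\<close> can then be reached, if at all, only by withholding items from these two
  edges, and the condition says that this does not pay.\<close>
definition diag_antimono_nonpos :: "(int \<Rightarrow> int \<Rightarrow> real) \<Rightarrow> bool" where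
  "diag_antimono_nonpos f \<longleftrightarrow> (\<forall>p q. p \<le> 0 \<or> q \<le> 0 \<longrightarrow> f p q \<le> f (p - 1) (q - 1))"

text \<open>The minimum of \<open>f\<close> over the states reachable from \<open>(p, q)\<close> by executing \<open>\<ell>\<^sub>2\<close> edges. The
  recursive form makes the commutation with pointwise limits a plain induction.\<close>
function running_min :: "(int \<Rightarrow> int \<Rightarrow> real) \<Rightarrow> int \<Rightarrow> int \<Rightarrow> real" where
  "running_min f p q = (if 0 < p \<and> 0 < q then min (f p q) (running_min f (p - 1) (q - 1)) else f p q)"
  by auto
termination by (relation "Wellfounded.measure (\<lambda>(f, p, q). nat p)") auto

declare running_min.simps [simp del]

lemma diagonal_induct [case_names nonpos pos]:
  assumes "\<And>p q. p \<le> 0 \<or> q \<le> 0 \<Longrightarrow> P p q"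
    and "\<And>p q. 0 < p \<Longrightarrow> 0 < q \<Longrightarrow> P (p - 1) (q - 1) \<Longrightarrow> P p q"
  shows "P (p :: int) (q :: int)"
proof (induction "nat p" arbitrary: p q rule: less_induct)
  case (less p q)
  show ?case
  proof (cases "p \<le> 0 \<or> q \<le> 0")
    case False
    then have "P (p - 1) (q - 1)"
      by (intro less) auto
    with False show ?thesis
      by (intro assms(2)[of p q]) auto
  qed (use assms(1) in simp)
qed

lemma running_min_nonpos: "p \<le> 0 \<or> q \<le> 0 \<Longrightarrow> running_min f p q = f p q"
  by (subst running_min.simps) auto

lemma running_min_pos:
  "0 < p \<Longrightarrow> 0 < q \<Longrightarrow> running_min f p q = min (f p q) (running_min f (p - 1) (q - 1))"
  by (subst running_min.simps) simp

lemma running_min_le: "running_min f p q \<le> f p q"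
  by (subst running_min.simps) auto

lemma running_min_mono:
  assumes "\<And>p q. f p q \<le> g p q"
  shows "running_min f p q \<le> running_min g p q"
  by (induction p q rule: diagonal_induct)
    (use assms in \<open>auto simp: running_min_nonpos running_min_pos min.coboundedI1 min.coboundedI2\<close>)

lemma running_min_tendsto:
  assumes "\<And>p q. (\<lambda>n. f n p q) \<longlonglongrightarrow> g p q"
  shows "(\<lambda>n. running_min (f n) p q) \<longlonglongrightarrow> running_min g p q"
  by (induction p q rule: diagonal_induct)
    (use assms in \<open>auto simp: running_min_nonpos running_min_pos intro!: tendsto_min\<close>)

lemma running_min_antimono:
  assumes "diag_antimono_nonpos f"
  shows "diag_antimono (running_min f)"
proof -
  have "running_min f p q \<le> running_min f (p - 1) (q - 1)" for p q
  proof (cases "p \<le> 0 \<or> q \<le> 0")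
    case True
    moreover from True have "p - 1 \<le> 0 \<or> q - 1 \<le> 0"
      by auto
    ultimately show ?thesis
      using assms[unfolded diag_antimono_nonpos_def, rule_format, OF True]
      by (simp add: running_min_nonpos)
  qed (simp add: running_min_pos not_le)
  then show ?thesis
    by (simp add: diag_antimono_def)
qed

text \<open>Walking up a diagonal, the running minimum follows \<open>f\<close> as long as \<open>f\<close> decreases; once \<open>f\<close>
  stops decreasing, convexity prevents it from decreasing again and the running minimum stays
  constant. A convex function that is frozen at its minimum is still convex. The assumption on the nonpositive part
  makes the two pieces fit together where the minimization starts.\<close>
lemma running_min_convex:
  assumes conv: "diag_convex f" and anti: "diag_antimono_nonpos f"
  shows "diag_convex (running_min f)"
proof -
  let ?R = "running_min f"
  have R_anti: "?R p q \<le> ?R (p - 1) (q - 1)" for p q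
    using running_min_antimono[OF anti] by (simp add: diag_antimono_def)
  have conv': "2 * f (p - 1) (q - 1) \<le> f p q + f (p - 1 - 1) (q - 1 - 1)" for p q
    using conv[unfolded diag_convex_def, rule_format, of "p - 1" "q - 1"] by simp
  \<comment> \<open>Either the minimum is still following \<open>f\<close>, or it is frozen and \<open>f\<close> has stopped decreasing.\<close>
  have phase: "(?R p q = f p q \<and> ?R (p - 1) (q - 1) = f (p - 1) (q - 1)) \<or>
      (?R p q = ?R (p - 1) (q - 1) \<and> f (p - 1) (q - 1) \<le> f p q)" for p q
  proof (induction p q rule: diagonal_induct)
    case (nonpos p q)
    moreover from nonpos have "p - 1 \<le> 0 \<or> q - 1 \<le> 0"
      by auto
    ultimately show ?case
      by (simp add: running_min_nonpos)
  next
    case (pos p q)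
    then show ?case
      using running_min_pos[OF pos(1,2), of f] conv'[of p q] running_min_le[of f "p - 1" "q - 1"]
      by (auto simp: min_def)
  qed
  have "2 * ?R (p - 1) (q - 1) \<le> ?R p q + ?R (p - 1 - 1) (q - 1 - 1)" for p q
    using phase[of p q] phase[of "p - 1" "q - 1"] R_anti[of "p - 1" "q - 1"] conv'[of p q]
    by auto
  from this[of "p + 1" "q + 1" for p q] show ?thesis
    by (simp add: diag_convex_def)
qed

lemma diag_antimono_iterate:
  assumes "diag_antimono f"
  shows "f p q \<le> f (p - int k) (q - int k)"
proof (induction k)
  case (Suc k)
  have "f (p - int k) (q - int k) \<le> f (p - int k - 1) (q - int k - 1)"
    using assms by (simp add: diag_antimono_def)
  with Suc show ?case
    by (simp add: algebra_simps)
qed simp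

text \<open>The points of a diagonal share the value of \<open>p - q\<close>, and \<open>min p q\<close> is the position on it. By
  convexity and monotonicity a running minimum that has once stopped decreasing is constant from
  there on; the threshold of the diagonal is the position where this happens first, or
  \<open>\<infinity>\<close> if it never does. Above the threshold the minimum is the value of \<open>f\<close> at the threshold.\<close>
lemma running_min_attained_at_threshold:
  assumes conv: "diag_convex f" and anti: "diag_antimono_nonpos f"
  shows "\<exists>t :: int \<Rightarrow> enat. \<forall>p q. running_min f p q =
    (let k = (case t (p - q) of enat s \<Rightarrow> nat (min p q - int s) | \<infinity> \<Rightarrow> 0)
     in f (p - int k) (q - int k))"
proof -
  let ?R = "running_min f"
  have R_anti: "?R p q \<le> ?R (p - 1) (q - 1)" for p q
    using running_min_antimono[OF anti] by (simp add: diag_antimono_def)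
  have R_conv: "2 * ?R (p - 1) (q - 1) \<le> ?R p q + ?R (p - 1 - 1) (q - 1 - 1)" for p q
    using running_min_convex[OF conv anti, unfolded diag_convex_def, rule_format, of "p - 1" "q - 1"]
    by simp
  \<comment> \<open>\<open>D i s\<close> is the running minimum at position \<open>s\<close> of the diagonal \<open>p - q = i\<close>.\<close>
  define D where "D i s = ?R (int s + max i 0) (int s + max (- i) 0)" for i :: int and s :: nat
  define flat where "flat i s \<longleftrightarrow> D i (Suc s) = D i s" for i s
  define t where "t i = (if \<exists>s. flat i s then enat (LEAST s. flat i s) else \<infinity>)" for i
  have D_min: "D (p - q) (nat (min p q)) = ?R p q" if "0 \<le> p" "0 \<le> q" for p q
  proof -
    have "int (nat (min p q)) + max (p - q) 0 = p" "int (nat (min p q)) + max (- (p - q)) 0 = q"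
      using that by auto
    then show ?thesis
      by (simp add: D_def)
  qed
  have flat_iff: "flat (p - q) (nat (min p q) - 1) \<longleftrightarrow> ?R p q = ?R (p - 1) (q - 1)"
    if "0 < p" "0 < q" for p q
  proof -
    have "nat (min p q) = Suc (nat (min p q) - 1)" "nat (min (p - 1) (q - 1)) = nat (min p q) - 1"
      using that by auto
    then show ?thesis
      using D_min[of p q] D_min[of "p - 1" "q - 1"] that by (simp add: flat_def)
  qed
  have flat_Suc: "flat i (Suc s)" if "flat i s" for i s
    using that R_anti[of "int (Suc (Suc s)) + max i 0" "int (Suc (Suc s)) + max (- i) 0"]
      R_conv[of "int (Suc (Suc s)) + max i 0" "int (Suc (Suc s)) + max (- i) 0"]
    by (simp add: flat_def D_def algebra_simps)
  have flat_up: "flat i s'" if "flat i s" "s \<le> s'" for i s s'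
    using that(2,1) by (induction rule: dec_induct) (auto intro: flat_Suc)
  have flatI: "?R p q = ?R (p - 1) (q - 1)"
    if "t (p - q) = enat s" "0 < p" "0 < q" "int s < min p q" for p q s
  proof -
    have "flat (p - q) s"
      using that by (auto simp: t_def intro: LeastI split: if_splits)
    then have "flat (p - q) (nat (min p q) - 1)"
      by (rule flat_up) (use that in auto)
    then show ?thesis
      using flat_iff that by simp
  qed
  have not_flatI: "?R p q \<noteq> ?R (p - 1) (q - 1)"
    if le: "\<And>s. t (p - q) = enat s \<Longrightarrow> min p q \<le> int s" and pos: "0 < p" "0 < q" for p q
  proof
    assume "?R p q = ?R (p - 1) (q - 1)"
    then have fl: "flat (p - q) (nat (min p q) - 1)"
      using flat_iff pos by simp
    then have "t (p - q) = enat (LEAST s. flat (p - q) s)"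
      by (auto simp: t_def)
    moreover have "(LEAST s. flat (p - q) s) \<le> nat (min p q) - 1"
      using fl by (rule Least_le)
    ultimately show False
      using le[of "LEAST s. flat (p - q) s"] pos by auto
  qed
  have "running_min f p q =
    (let k = (case t (p - q) of enat s \<Rightarrow> nat (min p q - int s) | \<infinity> \<Rightarrow> 0)
     in f (p - int k) (q - int k))" for p q
  proof (induction p q rule: diagonal_induct)
    case (nonpos p q)
    then have "nat (min p q - int s) = 0" for s
      by auto
    with nonpos show ?case
      by (simp add: running_min_nonpos split: enat.split)
  next
    case (pos p q)
    show ?case
    proof (cases "\<exists>s. t (p - q) = enat s \<and> int s < min p q")
      case True
      then obtain s where s: "t (p - q) = enat s" "int s < min p q"
        by blast
      define k where "k = nat (min (p - 1) (q - 1) - int s)"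
      have k: "nat (min p q - int s) = Suc k"
        using s(2) by (auto simp: k_def)
      have "?R p q = f (p - 1 - int k) (q - 1 - int k)"
        unfolding flatI[OF s(1) pos(1,2) s(2)] k_def using pos(3) s(1) by (simp add: Let_def)
      then show ?thesis
        unfolding s(1) enat.case k Let_def by (simp add: algebra_simps)
    next
      case False
      then have "?R p q \<noteq> ?R (p - 1) (q - 1)"
        using not_flatI[of p q] pos(1,2) by (meson not_le)
      then have "?R p q = f p q"
        using running_min_pos[OF pos(1,2), of f] by linarith
      then show ?thesis
        using False by (auto simp: not_less split: enat.split)
    qed
  qed
  then show ?thesis
    by blast
qed

section \<open>The optimality equation in the plane of excesses\<close>

text \<open>
  The cost of the state in which neither an \<open>\<ell>\<^sub>1\<close> nor an \<open>\<ell>\<^sub>3\<close> edge can be matched and in which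
  \<open>x\<^sub>1 - x\<^sub>0 = p\<close> and \<open>x\<^sub>2 - x\<^sub>3 = q\<close>.\<close>
definition excess_cost :: "(4 \<Rightarrow> real) \<Rightarrow> int \<Rightarrow> int \<Rightarrow> real" where
  "excess_cost c p q = c 0 * real_of_int (max (- p) 0) + c 1 * real_of_int (max p 0)
     + c 2 * real_of_int (max q 0) + c 3 * real_of_int (max (- q) 0)"

definition arrival_mean :: "4 pmf \<Rightarrow> (int \<Rightarrow> int \<Rightarrow> real) \<Rightarrow> int \<Rightarrow> int \<Rightarrow> real" where
  "arrival_mean \<mu> f p q = pmf \<mu> 0 * f (p - 1) q + pmf \<mu> 1 * f (p + 1) q
     + pmf \<mu> 2 * f p (q + 1) + pmf \<mu> 3 * f p (q - 1)"

definition arrival_cost :: "4 pmf \<Rightarrow> (4 \<Rightarrow> real) \<Rightarrow> real" where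
  "arrival_cost \<mu> c = pmf \<mu> 0 * c 0 + pmf \<mu> 1 * c 1 + pmf \<mu> 2 * c 2 + pmf \<mu> 3 * c 3"

text \<open>If the state left after matching is the one described by \<open>(p, q)\<close>, this is the expected cost of the
  next state plus the discounted value of the rest, when \<open>f\<close> values the position of the next state.\<close>
definition cost_to_go :: "4 pmf \<Rightarrow> real \<Rightarrow> (4 \<Rightarrow> real) \<Rightarrow> (int \<Rightarrow> int \<Rightarrow> real) \<Rightarrow> int \<Rightarrow> int \<Rightarrow> real" where
  "cost_to_go \<mu> \<gamma> c f p q = excess_cost c p q + arrival_cost \<mu> c + \<gamma> * arrival_mean \<mu> f p q"

lemma excess_cost_convex:
  assumes "admissible_cost c"
  shows "diag_convex (excess_cost c)"
proof -
  have nn: "0 \<le> c i" for i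
    using assms by (simp add: admissible_cost_def)
  have "2 * (a * real_of_int (max p 0)) \<le> a * real_of_int (max (p + 1) 0) + a * real_of_int (max (p - 1) 0)"
    if "0 \<le> a" for a :: real and p :: int
  proof -
    have "2 * real_of_int (max p 0) \<le> real_of_int (max (p + 1) 0) + real_of_int (max (p - 1) 0)"
      by (auto simp: max_def)
    from mult_left_mono[OF this that] show ?thesis
      by (simp add: algebra_simps)
  qed
  note pos_part = this
  have "2 * excess_cost c p q \<le> excess_cost c (p + 1) (q + 1) + excess_cost c (p - 1) (q - 1)" for p q
  proof -
    have "- p - 1 = - (p + 1)" "- p + 1 = - (p - 1)" "- q - 1 = - (q + 1)" "- q + 1 = - (q - 1)"
      by simp_all
    then show ?thesis
      using pos_part[OF nn[of 0], of "- p"] pos_part[OF nn[of 1], of p]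
        pos_part[OF nn[of 2], of q] pos_part[OF nn[of 3], of "- q"]
      unfolding excess_cost_def by simp
  qed
  then show ?thesis
    by (simp add: diag_convex_def)
qed

text \<open>Here the admissibility of the cost is used. Decreasing both excesses replaces, for instance, an
  item of class 2 by an item of class 0 if \<open>p \<le> 0 < q\<close>, which does not pay since
  \<open>c 2 \<le> c 0\<close>; if both excesses are nonpositive, it adds an item of each of the classes 0 and 3.\<close>
lemma excess_cost_antimono:
  assumes "admissible_cost c"
  shows "diag_antimono_nonpos (excess_cost c)"
  unfolding diag_antimono_nonpos_def
proof (intro allI impI)
  fix p q :: int
  assume "p \<le> 0 \<or> q \<le> 0"
  then consider "p \<le> 0" "q \<le> 0" | "p \<le> 0" "1 \<le> q" | "1 \<le> p" "q \<le> 0"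
    by linarith
  then show "excess_cost c p q \<le> excess_cost c (p - 1) (q - 1)"
    using assms unfolding admissible_cost_def excess_cost_def
    by cases (auto simp: max_def algebra_simps add_increasing)
qed

lemma cost_to_go_convex:
  assumes "admissible_cost c" "0 \<le> \<gamma>" "diag_convex f"
  shows "diag_convex (cost_to_go \<mu> \<gamma> c f)"
proof -
  have "2 * arrival_mean \<mu> f p q \<le> arrival_mean \<mu> f (p + 1) (q + 1) + arrival_mean \<mu> f (p - 1) (q - 1)" for p q
  proof -
    have "2 * (pmf \<mu> a * f p' q') \<le> pmf \<mu> a * f (p' + 1) (q' + 1) + pmf \<mu> a * f (p' - 1) (q' - 1)" for a p' q'
      using mult_left_mono[OF assms(3)[unfolded diag_convex_def, rule_format, of p' q'] pmf_nonneg[of \<mu> a]]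
      by (simp add: algebra_simps)
    from this[of 0 "p - 1" q] this[of 1 "p + 1" q] this[of 2 p "q + 1"] this[of 3 p "q - 1"]
    show ?thesis
      unfolding arrival_mean_def by (simp add: algebra_simps)
  qed
  from mult_left_mono[OF this \<open>0 \<le> \<gamma>\<close>] show ?thesis
    using excess_cost_convex[OF assms(1)]
    unfolding diag_convex_def cost_to_go_def by (smt (verit) distrib_left)
qed

lemma cost_to_go_antimono:
  assumes "admissible_cost c" "0 \<le> \<gamma>" "diag_antimono f"
  shows "diag_antimono_nonpos (cost_to_go \<mu> \<gamma> c f)"
proof -
  have "arrival_mean \<mu> f p q \<le> arrival_mean \<mu> f (p - 1) (q - 1)" for p q
  proof -
    have "pmf \<mu> a * f p' q' \<le> pmf \<mu> a * f (p' - 1) (q' - 1)" for a p' q'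
      using assms(3) by (auto simp: diag_antimono_def intro!: mult_left_mono)
    from this[of 0 "p - 1" q] this[of 1 "p + 1" q] this[of 2 p "q + 1"] this[of 3 p "q - 1"]
    show ?thesis
      unfolding arrival_mean_def by (simp add: algebra_simps)
  qed
  from mult_left_mono[OF this \<open>0 \<le> \<gamma>\<close>] show ?thesis
    using excess_cost_antimono[OF assms(1)]
    unfolding diag_antimono_nonpos_def cost_to_go_def by (meson add_mono order_refl)
qed

lemma sum_over_classes: "sum f (UNIV :: 4 set) = f 0 + f 1 + f 2 + f 3"
  for f :: "4 \<Rightarrow> real"
proof -
  have four: "(4 :: 4) = 0"
    by simp
  show ?thesis
    unfolding sum_4 four by simp
qed

lemma sum_pmf4: "pmf \<mu> 0 + pmf \<mu> 1 + pmf \<mu> 2 + pmf \<mu> (3 :: 4) = 1"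
  using sum_pmf_eq_1[of UNIV \<mu>] by (simp add: sum_over_classes)

lemma arrival_mean_mono:
  assumes "\<And>p q. f p q \<le> g p q"
  shows "arrival_mean \<mu> f p q \<le> arrival_mean \<mu> g p q"
  unfolding arrival_mean_def by (intro add_mono mult_left_mono assms pmf_nonneg)

lemma cost_to_go_mono:
  assumes "0 \<le> \<gamma>" "\<And>p q. f p q \<le> g p q"
  shows "cost_to_go \<mu> \<gamma> c f p q \<le> cost_to_go \<mu> \<gamma> c g p q"
  unfolding cost_to_go_def using assms by (intro add_left_mono mult_left_mono arrival_mean_mono)

lemma cost_to_go_tendsto:
  assumes "\<And>p q. (\<lambda>n. f n p q) \<longlonglongrightarrow> g p q"
  shows "(\<lambda>n. cost_to_go \<mu> \<gamma> c (f n) p q) \<longlonglongrightarrow> cost_to_go \<mu> \<gamma> c g p q"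
  unfolding cost_to_go_def arrival_mean_def by (intro tendsto_intros assms)

primrec value_iteration :: "4 pmf \<Rightarrow> real \<Rightarrow> (4 \<Rightarrow> real) \<Rightarrow> nat \<Rightarrow> int \<Rightarrow> int \<Rightarrow> real" where
  "value_iteration \<mu> \<gamma> c 0 = (\<lambda>p q. 0)"
| "value_iteration \<mu> \<gamma> c (Suc n) = running_min (cost_to_go \<mu> \<gamma> c (value_iteration \<mu> \<gamma> c n))"

lemma value_iteration_convex_antimono:
  assumes "admissible_cost c" "0 \<le> \<gamma>"
  shows "diag_convex (value_iteration \<mu> \<gamma> c n) \<and> diag_antimono (value_iteration \<mu> \<gamma> c n)"
proof (induction n)
  case 0
  then show ?case by (simp add: diag_convex_def diag_antimono_def)
next
  case (Suc n)
  then show ?case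
    by (simp add: assms running_min_convex running_min_antimono cost_to_go_convex cost_to_go_antimono)
qed

lemma cost_to_go_zero_nonneg:
  assumes "admissible_cost c"
  shows "0 \<le> cost_to_go \<mu> \<gamma> c (\<lambda>p q. 0) p q"
proof -
  have nn: "0 \<le> c i" for i
    using assms by (simp add: admissible_cost_def)
  have "0 \<le> excess_cost c p q"
    unfolding excess_cost_def by (intro add_nonneg_nonneg mult_nonneg_nonneg nn) auto
  moreover have "0 \<le> arrival_cost \<mu> c"
    unfolding arrival_cost_def by (intro add_nonneg_nonneg mult_nonneg_nonneg nn pmf_nonneg)
  ultimately show ?thesis
    by (simp add: cost_to_go_def arrival_mean_def)
qed

lemma running_min_nonneg:
  assumes "\<And>p q. 0 \<le> f p q"
  shows "0 \<le> running_min f p q"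
  by (induction p q rule: diagonal_induct) (use assms in \<open>auto simp: running_min_nonpos running_min_pos\<close>)

lemma value_iteration_mono:
  assumes "admissible_cost c" "0 \<le> \<gamma>"
  shows "value_iteration \<mu> \<gamma> c n p q \<le> value_iteration \<mu> \<gamma> c (Suc n) p q"
proof (induction n arbitrary: p q)
  case 0
  show ?case
    by (simp add: running_min_nonneg cost_to_go_zero_nonneg assms)
next
  case (Suc n)
  show ?case
    unfolding value_iteration.simps(2)[of _ _ _ "Suc n"]
    by (subst value_iteration.simps(2), rule running_min_mono, rule cost_to_go_mono[OF assms(2) Suc])
qed

text \<open>With \<open>M = c 0 + c 1 + c 2 + c 3\<close> one period costs at most \<open>M\<close> times the number of stored items
  including the new arrival, which adds one. The constants solve \<open>M + \<gamma> * a = a\<close> and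
  \<open>a + \<gamma> * b = b\<close> for the function \<open>a * (\<bar>p\<bar> + \<bar>q\<bar>) + b\<close>, which is therefore a supersolution.\<close>
definition linear_bound :: "real \<Rightarrow> (4 \<Rightarrow> real) \<Rightarrow> int \<Rightarrow> int \<Rightarrow> real" where
  "linear_bound \<gamma> c p q = (c 0 + c 1 + c 2 + c 3) / (1 - \<gamma>) * (real_of_int (\<bar>p\<bar> + \<bar>q\<bar>) + 1 / (1 - \<gamma>))"

lemma cost_to_go_linear_bound:
  assumes "admissible_cost c" "0 \<le> \<gamma>" "\<gamma> < 1"
  shows "cost_to_go \<mu> \<gamma> c (linear_bound \<gamma> c) p q \<le> linear_bound \<gamma> c p q"
proof -
  let ?M = "c 0 + c 1 + c 2 + c 3" and ?N = "real_of_int (\<bar>p\<bar> + \<bar>q\<bar>)"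
  define a where "a = ?M / (1 - \<gamma>)"
  have nn: "0 \<le> c i" for i
    using assms by (simp add: admissible_cost_def)
  have a_nonneg: "0 \<le> a"
    unfolding a_def using assms by (intro divide_nonneg_nonneg add_nonneg_nonneg nn) auto
  have excess: "excess_cost c p q \<le> ?M * ?N"
  proof -
    have "excess_cost c p q \<le> c 0 * ?N + c 1 * ?N + c 2 * ?N + c 3 * ?N"
      unfolding excess_cost_def by (intro add_mono mult_left_mono nn) auto
    then show ?thesis
      by (simp add: algebra_simps)
  qed
  have "arrival_cost \<mu> c \<le> 1 * c 0 + 1 * c 1 + 1 * c 2 + 1 * c 3"
    unfolding arrival_cost_def by (intro add_mono mult_right_mono nn pmf_le_1)
  then have arrival: "arrival_cost \<mu> c \<le> ?M"
    by simp
  have step: "linear_bound \<gamma> c p' q' \<le> a * (?N + 1 + 1 / (1 - \<gamma>))"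
    if "\<bar>p'\<bar> + \<bar>q'\<bar> \<le> \<bar>p\<bar> + \<bar>q\<bar> + 1" for p' q'
  proof -
    have "real_of_int (\<bar>p'\<bar> + \<bar>q'\<bar>) \<le> ?N + 1"
      using that by linarith
    then show ?thesis
      unfolding linear_bound_def a_def[symmetric] using a_nonneg by (intro mult_left_mono) auto
  qed
  have "arrival_mean \<mu> (linear_bound \<gamma> c) p q \<le> arrival_mean \<mu> (\<lambda>_ _. a * (?N + 1 + 1 / (1 - \<gamma>))) p q"
    unfolding arrival_mean_def
    by (linarith | rule mult_left_mono[OF step pmf_nonneg] | rule add_mono)+
  also have "\<dots> = (pmf \<mu> 0 + pmf \<mu> 1 + pmf \<mu> 2 + pmf \<mu> 3) * (a * (?N + 1 + 1 / (1 - \<gamma>)))"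
    unfolding arrival_mean_def by (simp add: algebra_simps)
  finally have mean: "arrival_mean \<mu> (linear_bound \<gamma> c) p q \<le> a * (?N + 1 + 1 / (1 - \<gamma>))"
    by (simp add: sum_pmf4)
  have M: "?M = (1 - \<gamma>) * a"
    using assms by (simp add: a_def)
  have "cost_to_go \<mu> \<gamma> c (linear_bound \<gamma> c) p q \<le> ?M * ?N + ?M + \<gamma> * (a * (?N + 1 + 1 / (1 - \<gamma>)))"
    unfolding cost_to_go_def using assms by (intro add_mono excess arrival mult_left_mono mean)
  also have "\<dots> = a * ?N + a * (1 + \<gamma> * (1 / (1 - \<gamma>)))"
    unfolding M by (simp only: algebra_simps)
  also have "1 + \<gamma> * (1 / (1 - \<gamma>)) = 1 / (1 - \<gamma>)"
    using assms by (simp add: field_simps)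
  also have "a * ?N + a * (1 / (1 - \<gamma>)) = a * (?N + 1 / (1 - \<gamma>))"
    by (simp only: distrib_left)
  finally show ?thesis
    by (simp only: linear_bound_def[of _ _ p q] a_def)
qed

lemma value_iteration_bounded:
  assumes "admissible_cost c" "0 \<le> \<gamma>" "\<gamma> < 1"
  shows "value_iteration \<mu> \<gamma> c n p q \<le> linear_bound \<gamma> c p q"
proof (induction n arbitrary: p q)
  case 0
  have "0 \<le> c i" for i
    using assms by (simp add: admissible_cost_def)
  then show ?case
    using assms by (simp add: linear_bound_def)
next
  case (Suc n)
  have "value_iteration \<mu> \<gamma> c (Suc n) p q \<le> cost_to_go \<mu> \<gamma> c (value_iteration \<mu> \<gamma> c n) p q"
    by (simp add: running_min_le)
  also have "\<dots> \<le> cost_to_go \<mu> \<gamma> c (linear_bound \<gamma> c) p q"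
    by (rule cost_to_go_mono[OF assms(2) Suc])
  also have "\<dots> \<le> linear_bound \<gamma> c p q"
    by (rule cost_to_go_linear_bound[OF assms])
  finally show ?case .
qed

text \<open>Value iteration from 0 increases and stays below the linear supersolution, hence converges.
  Convexity, monotonicity and the recursion itself survive pointwise limits.\<close>
lemma value_fixed_point:
  assumes "admissible_cost c" "0 \<le> \<gamma>" "\<gamma> < 1"
  obtains h where "diag_convex h" "diag_antimono h"
    "\<And>p q. running_min (cost_to_go \<mu> \<gamma> c h) p q = h p q"
    "\<And>p q. 0 \<le> h p q" "\<And>p q. h p q \<le> linear_bound \<gamma> c p q"
proof -
  let ?V = "value_iteration \<mu> \<gamma> c"
  define h where "h p q = lim (\<lambda>n. ?V n p q)" for p q
  have lim: "(\<lambda>n. ?V n p q) \<longlonglongrightarrow> h p q" for p q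
  proof -
    have "incseq (\<lambda>n. ?V n p q)"
      by (intro incseq_SucI value_iteration_mono assms)
    moreover have "\<forall>n. ?V n p q \<le> linear_bound \<gamma> c p q"
      using value_iteration_bounded[OF assms] by blast
    ultimately obtain L where "(\<lambda>n. ?V n p q) \<longlonglongrightarrow> L"
      by (rule incseq_convergent)
    then show ?thesis
      by (simp add: h_def limI)
  qed
  have "diag_convex h"
    unfolding diag_convex_def
  proof (intro allI)
    fix p q
    show "2 * h p q \<le> h (p + 1) (q + 1) + h (p - 1) (q - 1)"
      by (rule LIMSEQ_le[OF tendsto_mult[OF tendsto_const lim] tendsto_add[OF lim lim]])
        (use value_iteration_convex_antimono[OF assms(1,2)] in \<open>simp add: diag_convex_def\<close>)
  qed
  moreover have "diag_antimono h"
    unfolding diag_antimono_def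
  proof (intro allI)
    fix p q
    show "h p q \<le> h (p - 1) (q - 1)"
      by (rule LIMSEQ_le[OF lim lim])
        (use value_iteration_convex_antimono[OF assms(1,2)] in \<open>simp add: diag_antimono_def\<close>)
  qed
  moreover have "running_min (cost_to_go \<mu> \<gamma> c h) p q = h p q" for p q
  proof (rule LIMSEQ_unique)
    show "(\<lambda>n. ?V (Suc n) p q) \<longlonglongrightarrow> running_min (cost_to_go \<mu> \<gamma> c h) p q"
      by (simp add: running_min_tendsto cost_to_go_tendsto lim)
    show "(\<lambda>n. ?V (Suc n) p q) \<longlonglongrightarrow> h p q"
      by (rule LIMSEQ_Suc[OF lim])
  qed
  moreover have "0 \<le> h p q" for p q
  proof (rule LIMSEQ_le_const[OF lim])
    have "?V 0 p q \<le> ?V n p q" for n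
      by (rule lift_Suc_mono_le[of "\<lambda>n. ?V n p q"]) (auto intro!: value_iteration_mono assms simp del: value_iteration.simps)
    then show "\<exists>N. \<forall>n\<ge>N. 0 \<le> ?V n p q"
      by simp
  qed
  moreover have "h p q \<le> linear_bound \<gamma> c p q" for p q
    using lim by (rule LIMSEQ_le_const2) (use value_iteration_bounded[OF assms] in blast)
  ultimately show ?thesis
    by (rule that)
qed

section \<open>The optimality equation on states\<close>

definition excess01 :: "state \<Rightarrow> int" where
  "excess01 x = int (x $ 1) - int (x $ 0)"

definition excess23 :: "state \<Rightarrow> int" where
  "excess23 x = int (x $ 2) - int (x $ 3)"

text \<open>Among the states with given excesses, the one without \<open>\<ell>\<^sub>1\<close> and \<open>\<ell>\<^sub>3\<close> pairs is the cheapest: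
  this is why these two edges have priority.\<close>
lemma excess_cost_le_linear_cost:
  assumes "admissible_cost c"
  shows "excess_cost c (excess01 x) (excess23 x) \<le> linear_cost c x"
  unfolding excess_cost_def linear_cost_def
  using assms[unfolded admissible_cost_def]
  by (intro add_mono mult_left_mono) (auto simp: excess01_def excess23_def)

lemma excess_cost_eq_linear_cost:
  assumes "x $ 0 = 0 \<or> x $ 1 = 0" "x $ 2 = 0 \<or> x $ 3 = 0"
  shows "excess_cost c (excess01 x) (excess23 x) = linear_cost c x"
  using assms by (auto simp: excess_cost_def linear_cost_def excess01_def excess23_def)

text \<open>The cost is paid on the state before matching, while the future depends on this state only through
  its excesses, since executing the \<open>\<ell>\<^sub>1\<close> and \<open>\<ell>\<^sub>3\<close> edges does not change them.\<close>
definition state_value :: "real \<Rightarrow> (4 \<Rightarrow> real) \<Rightarrow> (int \<Rightarrow> int \<Rightarrow> real) \<Rightarrow> state \<Rightarrow> real" where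
  "state_value \<gamma> c h x = linear_cost c x + \<gamma> * h (excess01 x) (excess23 x)"

lemma expected_state_value:
  "(\<Sum>a\<in>UNIV. pmf \<mu> a * state_value \<gamma> c h (x + axis a 1)) =
    linear_cost c x + arrival_cost \<mu> c + \<gamma> * arrival_mean \<mu> h (excess01 x) (excess23 x)"
proof -
  let ?p = "excess01 x" and ?q = "excess23 x"
  have "(\<Sum>a\<in>UNIV. pmf \<mu> a * state_value \<gamma> c h (x + axis a 1)) =
      pmf \<mu> 0 * (linear_cost c x + c 0 + \<gamma> * h (?p - 1) ?q)
      + pmf \<mu> 1 * (linear_cost c x + c 1 + \<gamma> * h (?p + 1) ?q)
      + pmf \<mu> 2 * (linear_cost c x + c 2 + \<gamma> * h ?p (?q + 1))
      + pmf \<mu> 3 * (linear_cost c x + c 3 + \<gamma> * h ?p (?q - 1))"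
    by (simp add: sum_over_classes state_value_def linear_cost_def excess01_def excess23_def
        axis_def algebra_simps)
  also have "\<dots> = (pmf \<mu> 0 + pmf \<mu> 1 + pmf \<mu> 2 + pmf \<mu> 3) * linear_cost c x
      + arrival_cost \<mu> c + \<gamma> * arrival_mean \<mu> h ?p ?q"
    by (simp add: arrival_cost_def arrival_mean_def algebra_simps)
  finally show ?thesis
    by (simp add: sum_pmf4)
qed

text \<open>Only \<open>\<ell>\<^sub>2\<close> edges change the excesses, and each lowers both by one.\<close>
lemma decision_rule_excess:
  assumes "decision_rule u"
  obtains k where "excess01 (u x) = excess01 x - int k" "excess23 (u x) = excess23 x - int k"
proof -
  have le: "u x \<le> x" and "x - u x \<in> matchings x"
    using assms by (simp_all add: decision_rule_def)
  then obtain a b d where m: "x - u x = a *s edge1 + b *s edge2 + d *s edge3"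
    unfolding matchings_def by blast
  have le': "u x $ i \<le> x $ i" for i
    using le by (simp add: less_eq_vec_def)
  have comp: "x $ i - u x $ i = (a *s edge1 + b *s edge2 + d *s edge3) $ i" for i
    using m by (metis vector_minus_component)
  have "x $ 0 = u x $ 0 + a" "x $ 1 = u x $ 1 + a + b" "x $ 2 = u x $ 2 + b + d" "x $ 3 = u x $ 3 + d"
    using comp[of 0] comp[of 1] comp[of 2] comp[of 3] le'[of 0] le'[of 1] le'[of 2] le'[of 3]
    by (auto simp: edge1_def edge2_def edge3_def axis_def)
  then show ?thesis
    by (intro that[of b]) (auto simp: excess01_def excess23_def)
qed

lemma threshold_rule_excess:
  fixes t x
  defines "k \<equiv> num_edge2 (t (imbalance x)) x" and "y \<equiv> threshold_rule t x"
  shows "excess01 y = excess01 x - int k" "excess23 y = excess23 x - int k"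
    "y $ 0 = 0 \<or> y $ 1 = 0" "y $ 2 = 0 \<or> y $ 3 = 0"
proof -
  have k: "k = 0 \<or> (x $ 0 + k \<le> x $ 1 \<and> x $ 3 + k \<le> x $ 2)"
    by (auto simp: k_def num_edge2_def split: enat.split)
  have "y $ 0 = x $ 0 - min (x $ 0) (x $ 1)" "y $ 1 = x $ 1 - (min (x $ 0) (x $ 1) + k)"
    "y $ 2 = x $ 2 - (min (x $ 2) (x $ 3) + k)" "y $ 3 = x $ 3 - min (x $ 2) (x $ 3)"
    by (simp_all add: y_def k_def threshold_rule_def threshold_matching_def
        edge1_def edge2_def edge3_def axis_def)
  with k show "excess01 y = excess01 x - int k" "excess23 y = excess23 x - int k"
    "y $ 0 = 0 \<or> y $ 1 = 0" "y $ 2 = 0 \<or> y $ 3 = 0"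
    by (auto simp: excess01_def excess23_def min_def)
qed

lemma decision_rule_threshold: "decision_rule (threshold_rule t)"
proof -
  have "threshold_rule t x \<le> x \<and> x - threshold_rule t x = threshold_matching t x" for x
    using threshold_matching_mem[of t x]
    by (auto simp: matchings_def threshold_rule_def less_eq_vec_def vec_eq_iff)
  then show ?thesis
    using threshold_matching_mem by (simp add: decision_rule_def)
qed

text \<open>A decision may execute more \<open>\<ell>\<^sub>2\<close> edges than \<open>min p q\<close>, using items that \<open>\<ell>\<^sub>1\<close> or \<open>\<ell>\<^sub>3\<close> could
  have taken, and then leaves the range of the running minimum. The inequality still holds because
  \<open>h\<close> decreases along the whole diagonal, and \<open>h\<close> at the new excesses is at most the
  cost-to-go there.\<close>
lemma state_value_le_decision:
  assumes "admissible_cost c" "0 \<le> \<gamma>" "diag_antimono h"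
    and fp: "\<And>p q. running_min (cost_to_go \<mu> \<gamma> c h) p q = h p q"
    and "decision_rule u"
  shows "state_value \<gamma> c h x \<le> linear_cost c x + \<gamma> * (\<Sum>a\<in>UNIV. pmf \<mu> a * state_value \<gamma> c h (u x + axis a 1))"
proof -
  obtain k where k: "excess01 (u x) = excess01 x - int k" "excess23 (u x) = excess23 x - int k"
    using decision_rule_excess[OF assms(5)] .
  have "h (excess01 x) (excess23 x) \<le> h (excess01 (u x)) (excess23 (u x))"
    unfolding k by (rule diag_antimono_iterate[OF assms(3)])
  also have "\<dots> \<le> cost_to_go \<mu> \<gamma> c h (excess01 (u x)) (excess23 (u x))"
    by (metis fp running_min_le)
  also have "\<dots> \<le> (\<Sum>a\<in>UNIV. pmf \<mu> a * state_value \<gamma> c h (u x + axis a 1))"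
    unfolding expected_state_value cost_to_go_def
    using excess_cost_le_linear_cost[OF assms(1)] by simp
  finally show ?thesis
    using assms(2) by (simp add: state_value_def[of _ _ _ x] mult_left_mono)
qed

lemma state_value_eq_threshold:
  assumes "admissible_cost c" "0 \<le> \<gamma>" "diag_convex h" "diag_antimono h"
    and fp: "\<And>p q. running_min (cost_to_go \<mu> \<gamma> c h) p q = h p q"
  shows "\<exists>t. \<forall>x. state_value \<gamma> c h x = linear_cost c x
      + \<gamma> * (\<Sum>a\<in>UNIV. pmf \<mu> a * state_value \<gamma> c h (threshold_rule t x + axis a 1))"
proof -
  obtain t :: "int \<Rightarrow> enat" where t: "\<And>p q. h p q =
      (let k = (case t (p - q) of enat s \<Rightarrow> nat (min p q - int s) | \<infinity> \<Rightarrow> 0)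
       in cost_to_go \<mu> \<gamma> c h (p - int k) (q - int k))"
    using running_min_attained_at_threshold[OF
        cost_to_go_convex[OF assms(1,2,3)] cost_to_go_antimono[OF assms(1,2,4)], of \<mu>]
    unfolding fp by blast
  have "h (excess01 x) (excess23 x) =
      (\<Sum>a\<in>UNIV. pmf \<mu> a * state_value \<gamma> c h (threshold_rule t x + axis a 1))" for x
  proof -
    have "num_edge2 (t (imbalance x)) x = (case t (excess01 x - excess23 x) of
        enat s \<Rightarrow> nat (min (excess01 x) (excess23 x) - int s) | \<infinity> \<Rightarrow> 0)"
      by (simp add: num_edge2_def imbalance_def excess01_def excess23_def split: enat.split)
    then have "h (excess01 x) (excess23 x) =
        cost_to_go \<mu> \<gamma> c h (excess01 (threshold_rule t x)) (excess23 (threshold_rule t x))"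
      unfolding threshold_rule_excess by (subst t) (simp add: Let_def)
    then show ?thesis
      unfolding expected_state_value cost_to_go_def
      by (simp add: excess_cost_eq_linear_cost threshold_rule_excess(3,4))
  qed
  then have "state_value \<gamma> c h x = linear_cost c x
      + \<gamma> * (\<Sum>a\<in>UNIV. pmf \<mu> a * state_value \<gamma> c h (threshold_rule t x + axis a 1))" for x
    by (simp only: state_value_def[of _ _ _ x])
  then show ?thesis
    by blast
qed

section \<open>State processes under random policies\<close>

lemma measurable_decision: "(\<lambda>U. U n) \<in> operator_seq_space \<rightarrow>\<^sub>M operator_space"
  unfolding operator_seq_space_def by measurable

lemma measurable_decision_at: "(\<lambda>U. U n y) \<in> operator_seq_space \<rightarrow>\<^sub>M count_space UNIV"
  using measurable_decision[of n] unfolding operator_space_def by measurable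

lemma measurable_decision_path:
  assumes "sets P = sets operator_seq_space"
  shows "(\<lambda>\<omega>. fst \<omega> n) \<in> path_space \<mu> P \<rightarrow>\<^sub>M operator_space"
  unfolding path_space_def
  by (rule measurable_compose[OF measurable_fst])
    (use measurable_decision measurable_cong_sets[OF assms refl] in blast)

lemma measurable_decision_at_path:
  assumes "sets P = sets operator_seq_space"
  shows "(\<lambda>\<omega>. fst \<omega> n y) \<in> path_space \<mu> P \<rightarrow>\<^sub>M count_space UNIV"
  unfolding path_space_def
  by (rule measurable_compose[OF measurable_fst])
    (use measurable_decision_at measurable_cong_sets[OF assms refl] in blast)

lemma measurable_arrival: "(\<lambda>\<omega>. snd \<omega> n) \<in> path_space \<mu> P \<rightarrow>\<^sub>M count_space UNIV"
  unfolding path_space_def by measurable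

lemma measurable_state_at:
  assumes "sets P = sets operator_seq_space"
  shows "state_at x n \<in> path_space \<mu> P \<rightarrow>\<^sub>M count_space UNIV"
    and "(\<lambda>\<omega>. fst \<omega> n (state_at x n \<omega>)) \<in> path_space \<mu> P \<rightarrow>\<^sub>M count_space UNIV"
proof -
  have decision: "(\<lambda>\<omega>. fst \<omega> n (state_at x n \<omega>)) \<in> path_space \<mu> P \<rightarrow>\<^sub>M count_space UNIV"
    if "state_at x n \<in> path_space \<mu> P \<rightarrow>\<^sub>M count_space UNIV" for n
    by (rule measurable_compose_countable[OF measurable_decision_at_path[OF assms] that])
  show *: "state_at x n \<in> path_space \<mu> P \<rightarrow>\<^sub>M count_space UNIV"
  proof (induction n)
    case 0
    then show ?case by (simp add: measurable_count_space_const)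
  next
    case (Suc n)
    have "(\<lambda>\<omega>. y + axis (snd \<omega> (Suc n)) 1) \<in> path_space \<mu> P \<rightarrow>\<^sub>M count_space UNIV" for y :: state
      by (rule measurable_compose[OF measurable_arrival]) simp
    from measurable_compose_countable[OF this decision[OF Suc]] show ?case
      by simp
  qed
  show "(\<lambda>\<omega>. fst \<omega> n (state_at x n \<omega>)) \<in> path_space \<mu> P \<rightarrow>\<^sub>M count_space UNIV"
    by (rule decision[OF *])
qed

lemma prob_space_path:
  assumes "prob_space P"
  shows "prob_space (path_space \<mu> P)"
proof -
  interpret P: prob_space P by (rule assms)
  interpret Q: prob_space "\<Pi>\<^sub>M n\<in>(UNIV :: nat set). measure_pmf \<mu>"
    by (intro prob_space_PiM measure_pmf.prob_space_axioms)
  interpret PQ: pair_prob_space P "\<Pi>\<^sub>M n\<in>(UNIV :: nat set). measure_pmf \<mu>" ..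
  show ?thesis
    unfolding path_space_def by (rule PQ.prob_space_axioms)
qed

lemma AE_path_decisions:
  assumes "AE U in P. D U"
  shows "AE \<omega> in path_space \<mu> P. D (fst \<omega>)"
proof -
  interpret Q: prob_space "\<Pi>\<^sub>M n\<in>(UNIV :: nat set). measure_pmf \<mu>"
    by (intro prob_space_PiM measure_pmf.prob_space_axioms)
  have "AE U in distr (path_space \<mu> P) P fst. D U"
    unfolding path_space_def Q.distr_pair_fst by (rule assms)
  then show ?thesis
    by (rule AE_distrD[rotated]) (simp add: path_space_def)
qed

lemma state_at_cong:
  assumes "\<And>k. k \<le> n \<Longrightarrow> A k = B k"
  shows "state_at x n (U, A) = state_at x n (U, B)"
  using assms by (induction n) auto

text \<open>The state at time \<open>n\<close> depends only on the arrivals up to \<open>n\<close>. Splicing an independent copy of the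
  arrival sequence in from time \<open>n + 1\<close> on preserves the law, so the next arrival can be averaged
  separately, for every fixed realization of the decision rules.\<close>
lemma nn_integral_fresh_arrival:
  fixes \<mu> :: "4 pmf" and f :: "state \<Rightarrow> ennreal"
  shows "(\<integral>\<^sup>+ A. f (state_at x (Suc n) (U, A)) \<partial>(\<Pi>\<^sub>M n\<in>(UNIV :: nat set). measure_pmf \<mu>)) =
    (\<integral>\<^sup>+ A. \<integral>\<^sup>+ a. f (U n (state_at x n (U, A)) + axis a 1) \<partial>measure_pmf \<mu>
      \<partial>(\<Pi>\<^sub>M n\<in>(UNIV :: nat set). measure_pmf \<mu>))"
proof -
  interpret Q: sequence_space "measure_pmf \<mu>"
    by unfold_locales
  let ?Q = "\<Pi>\<^sub>M n\<in>(UNIV :: nat set). measure_pmf \<mu>"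
  have state: "(\<lambda>A. state_at x n (U, A)) \<in> ?Q \<rightarrow>\<^sub>M count_space UNIV" for n
  proof (induction n)
    case (Suc n)
    have "(\<lambda>A. A (Suc n)) \<in> ?Q \<rightarrow>\<^sub>M count_space UNIV"
      by measurable
    then have "(\<lambda>A. U n y + axis (A (Suc n)) 1) \<in> ?Q \<rightarrow>\<^sub>M count_space UNIV" for y
      by (rule measurable_compose) simp
    from measurable_compose_countable[OF this Suc] show ?case
      by simp
  qed simp
  have f_state: "(\<lambda>A. f (state_at x (Suc n) (U, A))) \<in> borel_measurable ?Q"
    by (rule measurable_compose[OF state]) simp
  have comb: "(\<lambda>(A, B). comb_seq (Suc n) A B) \<in> ?Q \<Otimes>\<^sub>M ?Q \<rightarrow>\<^sub>M ?Q"
    by (rule measurable_comb_seq)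
  have "(\<integral>\<^sup>+ A. f (state_at x (Suc n) (U, A)) \<partial>?Q) =
      (\<integral>\<^sup>+ A. f (state_at x (Suc n) (U, A)) \<partial>distr (?Q \<Otimes>\<^sub>M ?Q) ?Q (\<lambda>(A, B). comb_seq (Suc n) A B))"
    by (simp only: Q.PiM_comb_seq)
  also have "\<dots> = (\<integral>\<^sup>+ z. f (state_at x (Suc n) (U, case z of (A, B) \<Rightarrow> comb_seq (Suc n) A B)) \<partial>(?Q \<Otimes>\<^sub>M ?Q))"
    by (rule nn_integral_distr[OF comb]) (use f_state in simp)
  also have "\<dots> = (\<integral>\<^sup>+ A. \<integral>\<^sup>+ B. f (state_at x (Suc n) (U, comb_seq (Suc n) A B)) \<partial>?Q \<partial>?Q)"
    using Q.P.nn_integral_fst[OF measurable_compose[OF comb f_state]] by simp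
  also have "\<dots> = (\<integral>\<^sup>+ A. \<integral>\<^sup>+ a. f (U n (state_at x n (U, A)) + axis a 1) \<partial>measure_pmf \<mu> \<partial>?Q)"
  proof (rule nn_integral_cong)
    fix A
    have "state_at x n (U, comb_seq (Suc n) A B) = state_at x n (U, A)" for B
      by (rule state_at_cong) (simp add: comb_seq_less)
    moreover have "comb_seq (Suc n) A B (Suc n) = B 0" for B
      by (simp add: comb_seq_def)
    ultimately have "(\<integral>\<^sup>+ B. f (state_at x (Suc n) (U, comb_seq (Suc n) A B)) \<partial>?Q) =
        (\<integral>\<^sup>+ B. f (U n (state_at x n (U, A)) + axis (B 0) 1) \<partial>?Q)"
      by simp
    also have "\<dots> = (\<integral>\<^sup>+ a. f (U n (state_at x n (U, A)) + axis a 1) \<partial>distr ?Q (measure_pmf \<mu>) (\<lambda>B. B 0))"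
      by (subst nn_integral_distr) auto
    also have "distr ?Q (measure_pmf \<mu>) (\<lambda>B. B 0) = measure_pmf \<mu>"
      by (rule Q.PiM_component) simp
    finally show "(\<integral>\<^sup>+ B. f (state_at x (Suc n) (U, comb_seq (Suc n) A B)) \<partial>?Q) =
        (\<integral>\<^sup>+ a. f (U n (state_at x n (U, A)) + axis a 1) \<partial>measure_pmf \<mu>)" .
  qed
  finally show ?thesis .
qed

lemma nn_integral_state_at_Suc:
  fixes f :: "state \<Rightarrow> ennreal"
  assumes "sets P = sets operator_seq_space"
  shows "(\<integral>\<^sup>+ \<omega>. f (state_at x (Suc n) \<omega>) \<partial>path_space \<mu> P) =
    (\<integral>\<^sup>+ \<omega>. \<integral>\<^sup>+ a. f (fst \<omega> n (state_at x n \<omega>) + axis a 1) \<partial>measure_pmf \<mu> \<partial>path_space \<mu> P)"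
proof -
  let ?Q = "\<Pi>\<^sub>M n\<in>(UNIV :: nat set). measure_pmf \<mu>"
  interpret Q: prob_space ?Q
    by (intro prob_space_PiM measure_pmf.prob_space_axioms)
  have 1: "(\<lambda>\<omega>. f (state_at x (Suc n) \<omega>)) \<in> borel_measurable (P \<Otimes>\<^sub>M ?Q)"
    by (rule measurable_compose[OF measurable_state_at(1)[OF assms, unfolded path_space_def]]) simp
  have 2: "(\<lambda>\<omega>. \<integral>\<^sup>+ a. f (fst \<omega> n (state_at x n \<omega>) + axis a 1) \<partial>measure_pmf \<mu>) \<in> borel_measurable (P \<Otimes>\<^sub>M ?Q)"
    by (rule measurable_compose[OF measurable_state_at(2)[OF assms, unfolded path_space_def]]) simp
  show ?thesis
    unfolding path_space_def Q.nn_integral_fst[OF 1, symmetric] Q.nn_integral_fst[OF 2, symmetric] fst_conv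
    by (intro nn_integral_cong nn_integral_fresh_arrival)
qed

definition expected :: "4 pmf \<Rightarrow> (nat \<Rightarrow> state \<Rightarrow> state) measure \<Rightarrow> state \<Rightarrow> nat \<Rightarrow> (state \<Rightarrow> real) \<Rightarrow> ennreal" where
  "expected \<mu> P x n f = (\<integral>\<^sup>+ \<omega>. ennreal (f (state_at x n \<omega>)) \<partial>path_space \<mu> P)"

lemma nn_integral_pmf_classes:
  fixes \<mu> :: "4 pmf"
  assumes "\<And>a. 0 \<le> g a"
  shows "(\<integral>\<^sup>+ a. ennreal (g a) \<partial>measure_pmf \<mu>) = ennreal (\<Sum>a\<in>UNIV. pmf \<mu> a * g a)"
proof -
  have "(\<integral>\<^sup>+ a. ennreal (g a) \<partial>measure_pmf \<mu>) = (\<Sum>a\<in>UNIV. ennreal (g a) * ennreal (pmf \<mu> a))"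
    by (rule nn_integral_measure_pmf_support) auto
  also have "\<dots> = (\<Sum>a\<in>UNIV. ennreal (pmf \<mu> a * g a))"
    using assms by (simp add: ennreal_mult mult.commute)
  also have "\<dots> = ennreal (\<Sum>a\<in>UNIV. pmf \<mu> a * g a)"
    using assms by (intro sum_ennreal) simp
  finally show ?thesis .
qed

text \<open>The next arrival is averaged with the realization of the decision rules kept fixed. Hence the integrand
  on the right is the one-step cost of a single decision rule at a single state, and the optimality
  inequality can be applied to it pointwise.\<close>
lemma expected_one_step:
  assumes "sets P = sets operator_seq_space" "0 \<le> \<gamma>" and f: "\<And>y. 0 \<le> f y" and W: "\<And>y. 0 \<le> W y"
  shows "expected \<mu> P x n f + ennreal \<gamma> * expected \<mu> P x (Suc n) W =
    (\<integral>\<^sup>+ \<omega>. ennreal (f (state_at x n \<omega>) +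
      \<gamma> * (\<Sum>a\<in>UNIV. pmf \<mu> a * W (fst \<omega> n (state_at x n \<omega>) + axis a 1))) \<partial>path_space \<mu> P)"
proof -
  let ?S = "\<lambda>y. \<Sum>a\<in>UNIV. pmf \<mu> a * W (y + axis a 1)"
  have S: "0 \<le> ?S y" for y
    by (intro sum_nonneg mult_nonneg_nonneg W pmf_nonneg)
  have [measurable]: "(\<lambda>\<omega>. ennreal (f (state_at x n \<omega>))) \<in> borel_measurable (path_space \<mu> P)"
    by (rule measurable_compose[OF measurable_state_at(1)[OF assms(1)]]) simp
  have [measurable]: "(\<lambda>\<omega>. ennreal (?S (fst \<omega> n (state_at x n \<omega>)))) \<in> borel_measurable (path_space \<mu> P)"
    by (rule measurable_compose[OF measurable_state_at(2)[OF assms(1)]]) simp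
  have "expected \<mu> P x (Suc n) W = (\<integral>\<^sup>+ \<omega>. ennreal (?S (fst \<omega> n (state_at x n \<omega>))) \<partial>path_space \<mu> P)"
    unfolding expected_def nn_integral_state_at_Suc[OF assms(1), where f="\<lambda>y. ennreal (W y)"]
    by (simp only: nn_integral_pmf_classes W)
  then have "expected \<mu> P x n f + ennreal \<gamma> * expected \<mu> P x (Suc n) W = (\<integral>\<^sup>+ \<omega>. ennreal (f (state_at x n \<omega>))
      + ennreal \<gamma> * ennreal (?S (fst \<omega> n (state_at x n \<omega>))) \<partial>path_space \<mu> P)"
    by (simp add: expected_def nn_integral_add nn_integral_cmult del: One_nat_def state_at.simps)
  also have "\<dots> = (\<integral>\<^sup>+ \<omega>. ennreal (f (state_at x n \<omega>) + \<gamma> * ?S (fst \<omega> n (state_at x n \<omega>))) \<partial>path_space \<mu> P)"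
    by (simp only: ennreal_plus[OF f mult_nonneg_nonneg[OF assms(2) S]] ennreal_mult[OF assms(2) S])
  finally show ?thesis .
qed

definition stored :: "state \<Rightarrow> nat" where
  "stored x = (\<Sum>i\<in>UNIV. x $ i)"

lemma stored_state_at:
  assumes "\<And>n. decision_rule (fst \<omega> n)"
  shows "stored (state_at x n \<omega>) \<le> stored x + n"
proof (induction n)
  case (Suc n)
  have "fst \<omega> n y \<le> y" for y
    using assms by (simp add: decision_rule_def)
  then have "stored (fst \<omega> n y) \<le> stored y" for y
    unfolding stored_def less_eq_vec_def by (intro sum_mono) simp
  moreover have "stored (y + axis a 1) = stored y + 1" for y :: state and a
    by (simp add: stored_def sum.distrib axis_def)
  ultimately have "stored (state_at x (Suc n) \<omega>) \<le> stored (state_at x n \<omega>) + 1"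
    by (simp only: state_at.simps add_le_mono1)
  with Suc show ?case
    by simp
qed simp

section \<open>Comparison of the discounted cost with solutions of the optimality equation\<close>

lemma partial_costs_tendsto:
  "(\<lambda>N. \<Sum>n\<le>N. ennreal \<gamma> ^ n * expected \<mu> P x n f) \<longlonglongrightarrow> discounted_cost \<mu> \<gamma> f P x" if "0 \<le> \<gamma>"
proof -
  let ?S = "\<lambda>N. \<Sum>n\<le>N. ennreal \<gamma> ^ n * expected \<mu> P x n f"
  have "incseq ?S"
    by (intro incseq_SucI) simp
  then have "?S \<longlonglongrightarrow> (SUP N. ?S N)"
    by (rule LIMSEQ_SUP)
  moreover from this have "lim ?S = (SUP N. ?S N)"
    by (rule limI)
  ultimately show ?thesis
    using that by (simp add: discounted_cost_def expected_def ennreal_power)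
qed

lemma expected_0:
  assumes "prob_space P"
  shows "expected \<mu> P x 0 f = ennreal (f x)"
proof -
  interpret prob_space "path_space \<mu> P"
    by (rule prob_space_path[OF assms])
  show ?thesis
    by (simp add: expected_def emeasure_space_1)
qed

text \<open>Iterating the inequality \<open>N\<close> times bounds \<open>W x\<close> by the cost of the first \<open>N\<close> periods plus a
  remainder of order \<open>\<gamma>\<^sup>N * N\<close>: the number of stored items grows by at most one per period, and
  \<open>W\<close> grows at most linearly in it.\<close>
lemma discounted_cost_ge:
  assumes "prob_space P" and sets: "sets P = sets operator_seq_space"
    and rules: "AE U in P. \<forall>n. decision_rule (U n)"
    and \<gamma>: "0 \<le> \<gamma>" "\<gamma> < 1" and f: "\<And>y. 0 \<le> f y" and W: "\<And>y. 0 \<le> W y"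
    and K: "\<And>y. W y \<le> K * (1 + real (stored y))"
    and bellman: "\<And>u y. decision_rule u \<Longrightarrow> W y \<le> f y + \<gamma> * (\<Sum>a\<in>UNIV. pmf \<mu> a * W (u y + axis a 1))"
  shows "ennreal (W x) \<le> discounted_cost \<mu> \<gamma> f P x"
proof -
  interpret prob_space "path_space \<mu> P"
    by (rule prob_space_path[OF assms(1)])
  have AE_rules: "AE \<omega> in path_space \<mu> P. \<forall>n. decision_rule (fst \<omega> n)"
    by (rule AE_path_decisions[OF rules])
  have step: "expected \<mu> P x n W \<le> expected \<mu> P x n f + ennreal \<gamma> * expected \<mu> P x (Suc n) W" for n
    unfolding expected_one_step[where f=f and W=W, OF sets \<gamma>(1) f W] unfolding expected_def
    by (rule nn_integral_mono_AE, use AE_rules in eventually_elim) (intro ennreal_leI bellman, blast)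
  have iterate: "ennreal (W x) \<le> (\<Sum>n<N. ennreal \<gamma> ^ n * expected \<mu> P x n f) + ennreal \<gamma> ^ N * expected \<mu> P x N W" for N
  proof (induction N)
    case 0
    then show ?case by (simp add: expected_0[OF assms(1)])
  next
    case (Suc N)
    note Suc
    also have "(\<Sum>n<N. ennreal \<gamma> ^ n * expected \<mu> P x n f) + ennreal \<gamma> ^ N * expected \<mu> P x N W \<le>
        (\<Sum>n<N. ennreal \<gamma> ^ n * expected \<mu> P x n f)
        + ennreal \<gamma> ^ N * (expected \<mu> P x N f + ennreal \<gamma> * expected \<mu> P x (Suc N) W)"
      by (intro add_left_mono mult_left_mono step) simp
    finally show ?case
      by (simp add: algebra_simps)
  qed
  have tail: "ennreal \<gamma> ^ N * expected \<mu> P x N W \<le> ennreal (\<gamma> ^ N * (K * (1 + real (stored x + N))))" for N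
  proof -
    have "0 \<le> K"
      using K[of 0] W[of 0] by (simp add: stored_def)
    have bound: "W (state_at x N \<omega>) \<le> K * (1 + real (stored x + N))" if "\<forall>n. decision_rule (fst \<omega> n)" for \<omega>
    proof (rule order_trans[OF K mult_left_mono])
      show "1 + real (stored (state_at x N \<omega>)) \<le> 1 + real (stored x + N)"
        using stored_state_at[of \<omega> x N] that by (simp del: of_nat_add)
    qed (rule \<open>0 \<le> K\<close>)
    have "expected \<mu> P x N W \<le> (\<integral>\<^sup>+ \<omega>. ennreal (K * (1 + real (stored x + N))) \<partial>path_space \<mu> P)"
      unfolding expected_def
      by (rule nn_integral_mono_AE, use AE_rules in eventually_elim) (intro ennreal_leI bound)
    also have "\<dots> = ennreal (K * (1 + real (stored x + N)))"
      by (simp add: emeasure_space_1)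
    finally have "ennreal \<gamma> ^ N * expected \<mu> P x N W \<le> ennreal (\<gamma> ^ N) * ennreal (K * (1 + real (stored x + N)))"
      using \<gamma> by (simp add: ennreal_power mult_left_mono)
    then show ?thesis
      using \<gamma> \<open>0 \<le> K\<close> by (simp add: ennreal_mult)
  qed
  have "(\<lambda>N. \<gamma> ^ Suc N * (K * (1 + real (stored x + Suc N)))) \<longlonglongrightarrow> 0"
  proof (rule LIMSEQ_Suc)
    have "(\<lambda>N. \<gamma> ^ N) \<longlonglongrightarrow> 0"
      using \<gamma> by (rule LIMSEQ_realpow_zero)
    moreover have "(\<lambda>N. real N * \<gamma> ^ N) \<longlonglongrightarrow> 0"
      by (rule powser_times_n_limit_0) (use \<gamma> in simp)
    ultimately have "(\<lambda>N. K * (1 + real (stored x)) * \<gamma> ^ N + K * (real N * \<gamma> ^ N)) \<longlonglongrightarrow>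
        K * (1 + real (stored x)) * 0 + K * 0"
      by (intro tendsto_add tendsto_mult_left)
    then show "(\<lambda>N. \<gamma> ^ N * (K * (1 + real (stored x + N)))) \<longlonglongrightarrow> 0"
      by (simp add: algebra_simps)
  qed
  then have "(\<lambda>N. ennreal (\<gamma> ^ Suc N * (K * (1 + real (stored x + Suc N))))) \<longlonglongrightarrow> ennreal 0"
    by (rule tendsto_ennrealI)
  from tendsto_add[OF partial_costs_tendsto[OF \<gamma>(1)] this]
  have "(\<lambda>N. (\<Sum>n\<le>N. ennreal \<gamma> ^ n * expected \<mu> P x n f)
      + ennreal (\<gamma> ^ Suc N * (K * (1 + real (stored x + Suc N))))) \<longlonglongrightarrow> discounted_cost \<mu> \<gamma> f P x"
    by simp
  then show ?thesis
  proof (rule LIMSEQ_le_const, intro exI allI impI)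
    fix N
    show "ennreal (W x) \<le> (\<Sum>n\<le>N. ennreal \<gamma> ^ n * expected \<mu> P x n f)
      + ennreal (\<gamma> ^ Suc N * (K * (1 + real (stored x + Suc N))))"
      by (rule order_trans[OF iterate[of "Suc N"]])
        (simp only: lessThan_Suc_atMost add_left_mono tail)
  qed
qed

lemma AE_stationary_policy: "AE U in stationary_policy u. U = (\<lambda>n. u)"
proof -
  have "AE U in return operator_seq_space (\<lambda>n. u). \<forall>n y. U n y = u y"
  proof (subst AE_return)
    show "(\<lambda>n. u) \<in> space operator_seq_space"
      by (simp add: operator_seq_space_def operator_space_def space_PiM)
    have "Measurable.pred operator_seq_space (\<lambda>U. U n y = u y)" for n y
      by (rule measurable_compose[OF measurable_decision_at]) simp
    then show "Measurable.pred operator_seq_space (\<lambda>U. \<forall>n y. U n y = u y)"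
      by (intro pred_intros_countable)
  qed simp
  then show ?thesis
    unfolding stationary_policy_def by eventually_elim (simp add: fun_eq_iff)
qed

lemma prob_space_stationary_policy: "prob_space (stationary_policy u)"
  unfolding stationary_policy_def
  by (rule prob_space_return) (simp add: operator_seq_space_def operator_space_def space_PiM)

lemma sets_stationary_policy: "sets (stationary_policy u) = sets operator_seq_space"
  by (simp add: stationary_policy_def)

text \<open>After \<open>N\<close> iterations \<open>W x\<close> dominates the cost of the first \<open>N\<close> periods plus a nonnegative
  remainder, which is dropped.\<close>
lemma discounted_cost_stationary_le:
  assumes \<gamma>: "0 \<le> \<gamma>" and f: "\<And>y. 0 \<le> f y" and W: "\<And>y. 0 \<le> W y"
    and bellman: "\<And>y. f y + \<gamma> * (\<Sum>a\<in>UNIV. pmf \<mu> a * W (u y + axis a 1)) \<le> W y"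
  shows "discounted_cost \<mu> \<gamma> f (stationary_policy u) x \<le> ennreal (W x)"
proof -
  let ?P = "stationary_policy u"
  have const: "AE \<omega> in path_space \<mu> ?P. fst \<omega> = (\<lambda>n. u)"
    by (rule AE_path_decisions[OF AE_stationary_policy])
  have step: "expected \<mu> ?P x n f + ennreal \<gamma> * expected \<mu> ?P x (Suc n) W \<le> expected \<mu> ?P x n W" for n
    unfolding expected_one_step[where f=f and W=W, OF sets_stationary_policy \<gamma> f W] unfolding expected_def
    by (rule nn_integral_mono_AE, use const in eventually_elim) (simp only: ennreal_leI bellman)
  have iterate: "(\<Sum>n<N. ennreal \<gamma> ^ n * expected \<mu> ?P x n f) + ennreal \<gamma> ^ N * expected \<mu> ?P x N W \<le> ennreal (W x)" for N
  proof (induction N)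
    case 0
    then show ?case by (simp add: expected_0[OF prob_space_stationary_policy])
  next
    case (Suc N)
    have "(\<Sum>n<Suc N. ennreal \<gamma> ^ n * expected \<mu> ?P x n f) + ennreal \<gamma> ^ Suc N * expected \<mu> ?P x (Suc N) W
        = (\<Sum>n<N. ennreal \<gamma> ^ n * expected \<mu> ?P x n f)
        + ennreal \<gamma> ^ N * (expected \<mu> ?P x N f + ennreal \<gamma> * expected \<mu> ?P x (Suc N) W)"
      by (simp add: algebra_simps)
    also have "\<dots> \<le> (\<Sum>n<N. ennreal \<gamma> ^ n * expected \<mu> ?P x n f) + ennreal \<gamma> ^ N * expected \<mu> ?P x N W"
      by (intro add_left_mono mult_left_mono step) simp
    finally show ?case
      using Suc by (rule order_trans)
  qed
  show ?thesis
  proof (rule LIMSEQ_le_const2[OF partial_costs_tendsto[OF \<gamma>]], intro exI allI impI)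
    fix N
    show "(\<Sum>n\<le>N. ennreal \<gamma> ^ n * expected \<mu> ?P x n f) \<le> ennreal (W x)"
      using iterate[of "Suc N"] unfolding lessThan_Suc_atMost
      by (rule order_trans[rotated]) simp
  qed
qed

text \<open>Events of a deterministic decision rule have probability 0 or 1, hence are independent of
  everything.\<close>
lemma admissible_stationary_policy:
  assumes "decision_rule u"
  shows "admissible_policy \<mu> (stationary_policy u)"
proof -
  let ?P = "stationary_policy u"
  interpret prob_space "path_space \<mu> ?P"
    by (rule prob_space_path[OF prob_space_stationary_policy])
  have rules: "AE U in ?P. \<forall>n. decision_rule (U n)"
    using AE_stationary_policy[of u] by eventually_elim (simp add: assms)
  have const: "AE \<omega> in path_space \<mu> ?P. fst \<omega> n = u" for n
    using AE_path_decisions[OF AE_stationary_policy[of u], of \<mu>] by eventually_elim simp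
  have "indep_set (operator_events \<mu> ?P n) (history_events \<mu> ?P x n)" for x n
    unfolding indep_sets2_eq
  proof (intro conjI ballI)
    have dec: "(\<lambda>\<omega>. fst \<omega> n) \<in> path_space \<mu> ?P \<rightarrow>\<^sub>M operator_space"
      by (rule measurable_decision_path[OF sets_stationary_policy])
    have hist: "(\<lambda>\<omega>. \<lambda>p\<in>{..n}. state_at x p \<omega>) \<in> path_space \<mu> ?P \<rightarrow>\<^sub>M (\<Pi>\<^sub>M p\<in>{..n}. count_space UNIV)"
      by (intro measurable_restrict measurable_state_at sets_stationary_policy)
    have dec_fun: "(\<lambda>\<omega>. fst \<omega> n) \<in> space (path_space \<mu> ?P) \<rightarrow> space operator_space"
      using measurable_space[OF dec] by blast
    have hist_fun: "(\<lambda>\<omega>. \<lambda>p\<in>{..n}. state_at x p \<omega>)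
        \<in> space (path_space \<mu> ?P) \<rightarrow> space (\<Pi>\<^sub>M p\<in>{..n}. count_space UNIV)"
      using measurable_space[OF hist] by blast
    note op_eq = operator_events_def sets_vimage_algebra2[OF dec_fun]
    show op: "operator_events \<mu> ?P n \<subseteq> events"
      unfolding op_eq using measurable_sets[OF dec] by auto
    show hi: "history_events \<mu> ?P x n \<subseteq> events"
      unfolding history_events_def sets_vimage_algebra2[OF hist_fun]
      using measurable_sets[OF hist] by auto
    fix a b
    assume a: "a \<in> operator_events \<mu> ?P n" and b: "b \<in> history_events \<mu> ?P x n"
    obtain S where S: "a = (\<lambda>\<omega>. fst \<omega> n) -` S \<inter> space (path_space \<mu> ?P)"
      using a unfolding op_eq by blast
    have ev: "a \<in> events" "b \<in> events"
      using a b op hi by auto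
    show "prob (a \<inter> b) = prob a * prob b"
    proof (cases "u \<in> S")
      case True
      have "AE \<omega> in path_space \<mu> ?P. \<omega> \<in> a"
        using const[of n] AE_space by eventually_elim (simp add: S True)
      moreover from this have "prob (a \<inter> b) = prob b"
        using ev by (intro finite_measure_eq_AE) auto
      ultimately have "prob a = 1" "prob (a \<inter> b) = prob b"
        using ev by (simp_all add: prob_eq_1)
      then show ?thesis
        by simp
    next
      case False
      have "AE \<omega> in path_space \<mu> ?P. \<omega> \<notin> a"
        using const[of n] by eventually_elim (simp add: S False)
      then have "prob a = prob {}" "prob (a \<inter> b) = prob {}"
        using ev by (intro finite_measure_eq_AE; auto)+
      then show ?thesis
        by simp
    qed
  qed
  then show ?thesis
    using prob_space_stationary_policy rules by (simp add: admissible_policy_def sets_stationary_policy)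
qed

text \<open>This makes the remainder in the lower bound on the discounted cost vanish.\<close>
lemma state_value_linear_growth:
  assumes "admissible_cost c" "0 \<le> \<gamma>" "\<gamma> < 1" and "\<And>p q. h p q \<le> linear_bound \<gamma> c p q"
  shows "\<exists>K. \<forall>x. state_value \<gamma> c h x \<le> K * (1 + real (stored x))"
proof -
  let ?M = "c 0 + c 1 + c 2 + c 3"
  define a where "a = ?M / (1 - \<gamma>)"
  have nn: "0 \<le> c i" for i
    using assms by (simp add: admissible_cost_def)
  have M: "0 \<le> ?M"
    by (intro add_nonneg_nonneg nn)
  have a: "0 \<le> a" "0 \<le> a / (1 - \<gamma>)"
    unfolding a_def using assms M by (auto intro!: divide_nonneg_nonneg)
  have four: "(4 :: 4) = 0"
    by simp
  have stored: "stored x = x $ 0 + x $ 1 + x $ 2 + x $ 3" for x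
    unfolding stored_def sum_4 four by simp
  have "state_value \<gamma> c h x \<le> (?M + a + a / (1 - \<gamma>)) * (1 + real (stored x))" for x
  proof -
    let ?N = "real (stored x)"
    have "linear_cost c x \<le> c 0 * ?N + c 1 * ?N + c 2 * ?N + c 3 * ?N"
      unfolding linear_cost_def by (intro add_mono mult_left_mono nn) (simp_all add: stored)
    then have cost: "linear_cost c x \<le> ?M * ?N"
      by (simp add: algebra_simps)
    let ?L = "linear_bound \<gamma> c (excess01 x) (excess23 x)"
    have "real_of_int (\<bar>excess01 x\<bar> + \<bar>excess23 x\<bar>) \<le> ?N"
      by (simp add: stored excess01_def excess23_def)
    then have L: "?L \<le> a * (?N + 1 / (1 - \<gamma>))"
      unfolding linear_bound_def a_def[symmetric] by (intro mult_left_mono add_right_mono a)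
    have "0 \<le> ?L"
      unfolding linear_bound_def a_def[symmetric] using assms a by (intro mult_nonneg_nonneg) auto
    have "\<gamma> * h (excess01 x) (excess23 x) \<le> \<gamma> * ?L"
      by (intro mult_left_mono assms)
    also have "\<dots> \<le> ?L"
      using assms \<open>0 \<le> ?L\<close> by (simp add: mult_left_le_one_le)
    also note L
    finally have "state_value \<gamma> c h x \<le> ?M * ?N + (a * ?N + a / (1 - \<gamma>))"
      using cost by (simp add: state_value_def algebra_simps)
    also have "\<dots> \<le> ?M * (1 + ?N) + (a * (1 + ?N) + a / (1 - \<gamma>) * (1 + ?N))"
    proof (intro add_mono mult_left_mono M a)
      show "a / (1 - \<gamma>) \<le> a / (1 - \<gamma>) * (1 + ?N)"
        using mult_left_mono[OF _ a(2), of 1 "1 + ?N"] by simp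
    qed auto
    finally show ?thesis
      by (simp only: distrib_right add.assoc)
  qed
  then show ?thesis
    by blast
qed

section \<open>Optimality of a threshold policy\<close>

theorem theorem1:
  fixes \<mu> :: "4 pmf" and \<gamma> :: real and c :: "4 \<Rightarrow> real"
  assumes "0 < \<gamma>" and "\<gamma> < 1"
    and "admissible_cost c"
  shows "\<exists>t :: int \<Rightarrow> enat.
    admissible_policy \<mu> (stationary_policy (threshold_rule t)) \<and>
    (\<forall>x. discounted_cost \<mu> \<gamma> (linear_cost c) (stationary_policy (threshold_rule t)) x =
          (INF P\<in>{P. admissible_policy \<mu> P}. discounted_cost \<mu> \<gamma> (linear_cost c) P x))"
proof -
  have \<gamma>: "0 \<le> \<gamma>"
    using assms by simp
  obtain h where h: "diag_convex h" "diag_antimono h"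
    "\<And>p q. running_min (cost_to_go \<mu> \<gamma> c h) p q = h p q"
    "\<And>p q. 0 \<le> h p q" "\<And>p q. h p q \<le> linear_bound \<gamma> c p q"
    by (rule value_fixed_point[OF assms(3) \<gamma> assms(2), of \<mu>], erule that, simp_all)
  obtain t where t: "\<And>x. state_value \<gamma> c h x = linear_cost c x
      + \<gamma> * (\<Sum>a\<in>UNIV. pmf \<mu> a * state_value \<gamma> c h (threshold_rule t x + axis a 1))"
    using state_value_eq_threshold[OF assms(3) \<gamma> h(1,2,3)] by blast
  obtain K where K: "\<And>x. state_value \<gamma> c h x \<le> K * (1 + real (stored x))"
    using state_value_linear_growth[OF assms(3) \<gamma> assms(2) h(5)] by blast
  have cost_nonneg: "0 \<le> linear_cost c x" for x
    using assms(3) by (simp add: linear_cost_def admissible_cost_def)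
  have value_nonneg: "0 \<le> state_value \<gamma> c h x" for x
    using cost_nonneg[of x] h(4) \<gamma> by (simp add: state_value_def)
  let ?P = "stationary_policy (threshold_rule t)"
  have adm: "admissible_policy \<mu> ?P"
    by (rule admissible_stationary_policy[OF decision_rule_threshold])
  have upper: "discounted_cost \<mu> \<gamma> (linear_cost c) ?P x \<le> ennreal (state_value \<gamma> c h x)" for x
    by (rule discounted_cost_stationary_le[OF \<gamma> cost_nonneg value_nonneg]) (simp only: t[symmetric] order_refl)
  have lower: "ennreal (state_value \<gamma> c h x) \<le> discounted_cost \<mu> \<gamma> (linear_cost c) P x"
    if "admissible_policy \<mu> P" for P x
    using that unfolding admissible_policy_def
    by (intro discounted_cost_ge[where K=K] K \<gamma> assms cost_nonneg value_nonneg
        state_value_le_decision[OF assms(3) \<gamma> h(2,3)]) auto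
  have "discounted_cost \<mu> \<gamma> (linear_cost c) ?P x =
      (INF P\<in>{P. admissible_policy \<mu> P}. discounted_cost \<mu> \<gamma> (linear_cost c) P x)" for x
  proof (rule antisym)
    show "discounted_cost \<mu> \<gamma> (linear_cost c) ?P x \<le>
        (INF P\<in>{P. admissible_policy \<mu> P}. discounted_cost \<mu> \<gamma> (linear_cost c) P x)"
      by (rule INF_greatest, rule order_trans[OF upper lower]) simp
    show "(INF P\<in>{P. admissible_policy \<mu> P}. discounted_cost \<mu> \<gamma> (linear_cost c) P x) \<le>
        discounted_cost \<mu> \<gamma> (linear_cost c) ?P x"
      by (rule INF_lower) (simp add: adm)
  qed
  with adm show ?thesis
    by blast
qed

end
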